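(* Let $0<\omega\le\pi/2$. There exists an adaptive probing strategy which, for every $n$ and every convex polygon $\mathcal{O}$ with $n$ vertices all of whose internal angles are strictly larger than $\omega$, determines $\mathcal{O}$ exactly (all its vertices) using at most $2n-2$ $\omega$-probes.
   Context: An $\omega$-wedge $\mathcal{W}(\omega,q,H_1,H_2)$ is the closed region formed by a point $q$ (the apex), two rays $H_1,H_2$ emanating from $q$ with angle $\omega$ between them such that $H_2$ is obtained from $H_1$ by a counterclockwise rotation by $\omega$, and all points between them. A valid $\omega$-probe of a convex polygon $\mathcal{O}$ with respect to a directed line $\overrightarrow{L}$ is an $\omega$-wedge containing $\mathcal{O}$, each of whose rays contains at least one point of $\mathcal{O}$, whose apex $q$ lies on $\overrightarrow{L}$, and such that the ray from $q$ in the direction of $\overrightarrow{L}$ intersects $\mathcal{O}$. Probing model: $\mathcal{O}$ is unknown to the prober, who knows only a point $p\in\mathcal{O}$ and a circle $\Psi$ with $\mathcal{O}$ contained in the disk bounded by $\Psi$ (the number $n$ of vertices is not known). One $\omega$-probe consists of the prober choosing a directed line $\overrightarrow{L}$; if a valid $\omega$-probe of $\mathcal{O}$ with respect to $\overrightarrow{L}$ exists, the prober receives its apex $q$, its rays $H_1,H_2$, and the points $p_1\in\mathcal{O}\cap H_1$, $p_2\in\mathcal{O}\cap H_2$ closest to $q$; otherwise the prober is told only that the probe missed $\mathcal{O}$. (If more than one valid probe exists, which happens only when the apex is a vertex of $\mathcal{O}$ of internal angle less than $\omega$, any one of them may be returned.) A strategy is adaptive: each chosen line may depend on all previous outcomes.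 *)

theory Defs
  imports "HOL-Analysis.Analysis"
begin

definition convex_polygon :: "complex set \<Rightarrow> bool" where
  "convex_polygon V \<longleftrightarrow> finite V \<and> card V \<ge> 3 \<and> (\<forall>v\<in>V. v \<notin> convex hull (V - {v}))"

definition cross :: "complex \<Rightarrow> complex \<Rightarrow> real" where
  "cross u w = Im (cnj u * w)"

definition poly_edge :: "complex set \<Rightarrow> complex \<Rightarrow> complex \<Rightarrow> bool" where
  "poly_edge V a b \<longleftrightarrow> a \<in> V \<and> b \<in> V \<and> a \<noteq> b \<and>
     ((\<forall>x\<in>V. cross (b - a) (x - a) \<ge> 0) \<or> (\<forall>x\<in>V. cross (b - a) (x - a) \<le> 0))"

definition vec_angle :: "complex \<Rightarrow> complex \<Rightarrow> real" where
  "vec_angle u w = arccos ((u \<bullet> w) / (norm u * norm w))"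

definition angles_gt :: "real \<Rightarrow> complex set \<Rightarrow> bool" where
  "angles_gt \<omega> V \<longleftrightarrow> (\<forall>v a b. poly_edge V v a \<and> poly_edge V v b \<and> a \<noteq> b \<longrightarrow>
       vec_angle (a - v) (b - v) > \<omega>)"

definition ray :: "complex \<Rightarrow> complex \<Rightarrow> complex set" where
  "ray q d = {q + of_real t * d | t. t \<ge> 0}"

text \<open>The \<omega>-wedge with apex q whose first ray has direction d; the second ray is obtained
  by counterclockwise rotation by \<omega> (for 0 < \<omega> < pi the region between them is this cone).\<close>
definition wedge :: "real \<Rightarrow> complex \<Rightarrow> complex \<Rightarrow> complex set" where
  "wedge \<omega> q d = {q + of_real s * d + of_real t * (cis \<omega> * d) | s t. s \<ge> 0 \<and> t \<ge> 0}"

definition line_pts :: "complex \<Rightarrow> complex \<Rightarrow> complex set" where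
  "line_pts a u = {a + of_real t * u | t. True}"

definition valid_probe :: "real \<Rightarrow> complex set \<Rightarrow> complex \<times> complex \<Rightarrow> complex \<Rightarrow> real \<Rightarrow> bool" where
  "valid_probe \<omega> Ob L q \<theta> \<longleftrightarrow>
     q \<in> line_pts (fst L) (snd L) \<and>
     Ob \<subseteq> wedge \<omega> q (cis \<theta>) \<and>
     Ob \<inter> ray q (cis \<theta>) \<noteq> {} \<and> Ob \<inter> ray q (cis (\<theta> + \<omega>)) \<noteq> {} \<and>
     Ob \<inter> ray q (snd L) \<noteq> {}"

definition closest_on :: "complex set \<Rightarrow> complex \<Rightarrow> complex \<Rightarrow> bool" where
  "closest_on S q x \<longleftrightarrow> x \<in> S \<and> (\<forall>y\<in>S. dist q x \<le> dist q y)"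

text \<open>Answer of a probe: None = missed; Some (q, \<theta>, p1, p2) = apex, rays (first ray
  direction cis \<theta>, second cis (\<theta>+\<omega>)), and the closest points of Ob on the rays.\<close>
type_synonym response = "(complex \<times> real \<times> complex \<times> complex) option"

definition admissible :: "real \<Rightarrow> complex set \<Rightarrow> complex \<times> complex \<Rightarrow> response \<Rightarrow> bool" where
  "admissible \<omega> Ob L r \<longleftrightarrow>
     (case r of
        None \<Rightarrow> \<not> (\<exists>q \<theta>. valid_probe \<omega> Ob L q \<theta>)
      | Some (q, \<theta>, p1, p2) \<Rightarrow> valid_probe \<omega> Ob L q \<theta> \<and>
            closest_on (Ob \<inter> ray q (cis \<theta>)) q p1 \<and>
            closest_on (Ob \<inter> ray q (cis (\<theta> + \<omega>))) q p2)"

text \<open>A strategy sees the known data (p, centre c and radius R of \<Psi>) and the list of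
  previous answers, and either issues a probe along a directed line (a,u) or outputs
  a vertex set.\<close>
datatype action = Probe "complex \<times> complex" | Answer "complex set"

type_synonym strategy = "complex \<times> complex \<times> real \<Rightarrow> response list \<Rightarrow> action"

fun determines :: "real \<Rightarrow> strategy \<Rightarrow> complex \<times> complex \<times> real \<Rightarrow> complex set \<Rightarrow> nat
                     \<Rightarrow> response list \<Rightarrow> bool" where
  "determines \<omega> S i V 0 h = (S i h = Answer V)"
| "determines \<omega> S i V (Suc k) h =
     (case S i h of
        Answer A \<Rightarrow> A = V
      | Probe L \<Rightarrow> snd L \<noteq> 0 \<and>
          (\<forall>r. admissible \<omega> (convex hull V) L r \<longrightarrow> determines \<omega> S i V k (h @ [r])))"

end

theory Submission
  imports Defs
begin

text \<open>The first probe goes through \<open>p\<close>; every later one goes along the line through two known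
  vertices \<open>a\<close>, \<open>b\<close> that are adjacent on the hull of the known vertices and whose edge is not yet
  confirmed, i.e. no wedge seen so far lies to the left of \<open>ab\<close>. If \<open>ab\<close> is an edge, one ray of the
  answer is flush with it, which confirms it; otherwise both contacts lie strictly off the line, one
  on each side, and the right one is a new vertex. Hence each probe gains at least one of the \<open>2n\<close>
  items consisting of the \<open>n\<close> vertices and the \<open>n\<close> edges. The first probe gains two of them, and so
  does the second: only two vertices were known, so it yields either two new vertices or, since the
  contact on the other ray is off the line, an edge together with a new vertex.\<close>

section \<open>Cross products, tangents from a point, and directed hull edges\<close>

lemma cross_eq: "cross u w = Re u * Im w - Im u * Re w"
  by (simp add: cross_def)

lemma cross_diff_right: "cross u (w - z) = cross u w - cross u z"
  by (simp add: cross_eq algebra_simps)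

lemma cross_combination:
  "cross (of_real k * d + of_real l * e) w = k * cross d w + l * cross e w"
  by (simp add: cross_eq algebra_simps)

lemma cross_swap: "cross u w = - cross w u"
  by (simp add: cross_eq algebra_simps)

definition left_of :: "complex \<Rightarrow> complex \<Rightarrow> complex set" where
  "left_of a b = {x. cross (b - a) (x - a) \<ge> 0}"

text \<open>Edges are directed counterclockwise, so that each side of a polygon occurs once. A
  two-point set \<open>{a, b}\<close> counts as a degenerate polygon with the two edges
  \<open>(a, b)\<close> and \<open>(b, a)\<close>; this is the situation when only two vertices are
  known.\<close>

definition hull_edges :: "complex set \<Rightarrow> (complex \<times> complex) set" where
  "hull_edges K = {(a, b). a \<in> K \<and> b \<in> K \<and> a \<noteq> b \<and> K \<subseteq> left_of a b}"

lemma cross_eq_0_imp_scaleR: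
  assumes "cross u w = 0" "u \<noteq> 0"
  obtains t where "w = of_real t * u"
proof
  have "Re u * Im w = Im u * Re w"
    using assms(1) by (simp add: cross_eq)
  moreover have "(Re u)\<^sup>2 + (Im u)\<^sup>2 \<noteq> 0"
    using assms(2) by (simp add: complex_eq_iff sum_power2_eq_zero_iff)
  \<comment> \<open>The coefficient is that of the orthogonal projection of \<open>w\<close> onto
    \<open>u\<close>, which is \<open>w\<close> itself when the two are parallel.\<close>
  ultimately show "w = of_real ((u \<bullet> w) / (norm u)\<^sup>2) * u"
    unfolding complex_eq_iff cmod_power2 inner_complex_def
    by (simp add: divide_simps) (simp add: algebra_simps power2_eq_square)
qed

text \<open>Of three distinct collinear points one lies between the other two, hence in the convex
  hull of the remaining vertices.\<close>

lemma convex_polygon_not_collinear: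
  assumes V: "convex_polygon V" and "a \<in> V" "b \<in> V" "x \<in> V" "a \<noteq> b" "x \<noteq> a" "x \<noteq> b"
  shows "cross (b - a) (x - a) \<noteq> 0"
proof
  assume "cross (b - a) (x - a) = 0"
  with \<open>a \<noteq> b\<close> obtain t where "x - a = of_real t * (b - a)"
    using cross_eq_0_imp_scaleR[of "b - a" "x - a"] by auto
  then have "x = t *\<^sub>R b + (1 - t) *\<^sub>R a"
    by (simp add: scaleR_conv_of_real algebra_simps)
  then have "collinear {b, x, a}"
    unfolding collinear_3_expand by blast
  then have "collinear {a, b, x}"
    by (simp add: insert_commute)
  then have "between (b, x) a \<or> between (x, a) b \<or> between (a, b) x"
    using collinear_between_cases by blast
  moreover have "\<not> between (y, z) w" if "w \<in> V" "y \<in> V" "z \<in> V" "w \<noteq> y" "w \<noteq> z" for w y z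
  proof
    assume "between (y, z) w"
    then have "w \<in> convex hull {y, z}"
      by (simp add: between_mem_segment segment_convex_hull)
    also have "\<dots> \<subseteq> convex hull (V - {w})"
      using that by (intro hull_mono) auto
    finally show False
      using V that(1) by (simp add: convex_polygon_def)
  qed
  ultimately show False
    using assms by metis
qed

text \<open>A line separating \<open>v\<close> from the hull puts all of \<open>K\<close> into an
  open half-plane as seen from \<open>v\<close>. There the directions from \<open>v\<close> are
  linearly ordered by angle, and the tangent points are the first and the last one.\<close>

lemma tangent_points:
  fixes K :: "complex set"
  assumes "finite K" "K \<noteq> {}" "v \<notin> convex hull K"
  obtains a b where "a \<in> K" "b \<in> K"
    "\<forall>x\<in>K. cross (a - v) (x - v) \<ge> 0" "\<forall>x\<in>K. cross (b - v) (x - v) \<le> 0"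
proof -
  have "closed (convex hull K)"
    using assms(1) by (simp add: compact_imp_closed finite_imp_compact_convex_hull)
  then obtain d \<beta> where d: "d \<bullet> v < \<beta>" "\<And>x. x \<in> convex hull K \<Longrightarrow> d \<bullet> x > \<beta>"
    using separating_hyperplane_closed_point[of "convex hull K" v] assms by auto
  have pos: "d \<bullet> (x - v) > 0" if "x \<in> K" for x
    using d that by (metis diff_gt_0_iff_gt hull_inc inner_diff_right less_trans)
  \<comment> \<open>This is the tangent of the angle from \<open>d\<close> to \<open>x - v\<close>;
    the denominator is positive on \<open>K\<close>, so it orders the directions.\<close>
  define slope where "slope x = cross d (x - v) / (d \<bullet> (x - v))" for x
  have "d \<noteq> 0"
    using pos assms(2) by fastforce
  then have norm: "(norm d)\<^sup>2 > 0"
    by simp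
  have key: "cross (y - v) (x - v) \<ge> 0" if "x \<in> K" "y \<in> K" "slope y \<le> slope x" for x y
  proof -
    have "cross d (y - v) * (d \<bullet> (x - v)) \<le> cross d (x - v) * (d \<bullet> (y - v))"
      using that pos[OF that(1)] pos[OF that(2)] by (simp add: slope_def divide_simps)
    moreover have "(norm d)\<^sup>2 * cross (y - v) (x - v)
      = cross d (x - v) * (d \<bullet> (y - v)) - cross d (y - v) * (d \<bullet> (x - v))"
      unfolding cmod_power2 cross_eq inner_complex_def by algebra
    ultimately show ?thesis
      using norm by (metis diff_ge_0_iff_ge zero_le_mult_iff not_less)
  qed
  have "slope ` K \<noteq> {}" "finite (slope ` K)"
    using assms by auto
  then obtain a b where ab: "a \<in> K" "slope a = Min (slope ` K)" "b \<in> K" "slope b = Max (slope ` K)"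
    by (metis Min_in Max_in imageE)
  show ?thesis
  proof
    show "\<forall>x\<in>K. cross (a - v) (x - v) \<ge> 0"
      using ab assms(1) by (intro ballI key) auto
    show "\<forall>x\<in>K. cross (b - v) (x - v) \<le> 0"
    proof
      show "cross (b - v) (x - v) \<le> 0" if "x \<in> K" for x
        using key[of b x] ab assms(1) that by (subst cross_swap) auto
    qed
  qed (use ab in auto)
qed

text \<open>Each of two successors of \<open>a\<close> would lie to the left of the edge to the
  other, so the three vertices would be collinear.\<close>

lemma hull_edges_functional:
  assumes "convex_polygon V" "(a, b) \<in> hull_edges V" "(a, b') \<in> hull_edges V"
  shows "b = b'"
proof (rule ccontr)
  assume "b \<noteq> b'"
  have "cross (b - a) (b' - a) \<ge> 0" "cross (b' - a) (b - a) \<ge> 0"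
    using assms by (auto simp: hull_edges_def left_of_def)
  then have "cross (b - a) (b' - a) = 0"
    using cross_swap[of "b - a" "b' - a"] by simp
  then show False
    using convex_polygon_not_collinear[of V a b b'] assms \<open>b \<noteq> b'\<close> by (auto simp: hull_edges_def)
qed

lemma finite_hull_edges:
  assumes "finite K"
  shows "finite (hull_edges K)"
proof -
  have "hull_edges K \<subseteq> K \<times> K"
    by (auto simp: hull_edges_def)
  then show ?thesis
    using assms finite_subset by auto
qed

lemma card_hull_edges_le:
  assumes "convex_polygon V"
  shows "card (hull_edges V) \<le> card V"
proof (rule card_inj_on_le[where f = fst])
  show "inj_on fst (hull_edges V)"
    using hull_edges_functional[OF assms] by (auto simp: inj_on_def)
  show "fst ` hull_edges V \<subseteq> V"
    by (auto simp: hull_edges_def)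
qed (use assms in \<open>simp add: convex_polygon_def\<close>)

text \<open>This is the stopping criterion of the strategy. A missing vertex \<open>v\<close> lies
  outside the hull of \<open>K\<close>, so some hull edge \<open>(b, a)\<close> of \<open>K\<close>
  ending at a tangent point \<open>a\<close> of \<open>v\<close> has \<open>v\<close> strictly on
  its right; such an edge is not an edge of \<open>V\<close>.\<close>

lemma hull_edges_subset_imp_eq:
  assumes V: "convex_polygon V" and K: "K \<subseteq> V" "card K \<ge> 2" "hull_edges K \<subseteq> hull_edges V"
  shows "K = V"
proof (rule ccontr)
  assume "K \<noteq> V"
  then obtain v where v: "v \<in> V" "v \<notin> K"
    using K by auto
  have fin: "finite K"
    using V K(1) finite_subset by (auto simp: convex_polygon_def)
  have notin: "w \<notin> convex hull (K - {w})" if "w \<in> V" for w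
    using V K(1) that hull_mono[of "K - {w}" "V - {w}" convex] by (auto simp: convex_polygon_def)
  have "K \<noteq> {}"
    using K(2) by auto
  have "v \<notin> convex hull K"
    using notin[OF v(1)] v(2) by simp
  then obtain a where a: "a \<in> K" "\<forall>x\<in>K. cross (a - v) (x - v) \<ge> 0"
    using tangent_points[OF fin \<open>K \<noteq> {}\<close>] by metis
  have "K - {a} \<noteq> {}" "finite (K - {a})" "a \<notin> convex hull (K - {a})"
    using K(2) card_mono[of "{a}" K] fin notin[of a] a(1) K(1) by auto
  \<comment> \<open>The predecessor of \<open>a\<close> on the hull of \<open>K\<close> is a tangent
    point of the other points as seen from \<open>a\<close>.\<close>
  then obtain b where b: "b \<in> K" "b \<noteq> a" "\<forall>x\<in>K - {a}. cross (b - a) (x - a) \<le> 0"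
    using tangent_points[of "K - {a}" a] by (metis DiffD1 DiffD2 singletonI)
  have "cross (a - b) (x - b) \<ge> 0" if "x \<in> K" for x
    using b(3) that by (cases "x = a") (auto simp: cross_eq algebra_simps)
  then have "(b, a) \<in> hull_edges K"
    using a b by (auto simp: hull_edges_def left_of_def)
  then have "cross (a - b) (v - b) \<ge> 0"
    using K(3) v(1) by (auto simp: hull_edges_def left_of_def)
  moreover have "cross (a - v) (b - v) \<ge> 0"
    using a b by simp
  ultimately have "cross (a - v) (b - v) = 0"
    by (simp add: cross_eq algebra_simps)
  then show False
    using convex_polygon_not_collinear[OF V, of v a b] v a b K by auto
qed

section \<open>Wedges and their rays described by cross products\<close>

lemma cross_cis: "cross (cis a) (cis b) = sin (b - a)"
  by (simp add: cross_eq sin_diff)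

text \<open>Cramer's rule with the determinant multiplied out; it gives the coordinates of a point
  with respect to the two ray directions.\<close>

lemma cross_cramer:
  "of_real (cross d e) * z = of_real (cross z e) * d + of_real (cross d z) * e"
  by (simp add: complex_eq_iff cross_eq algebra_simps)

text \<open>The coordinates of \<open>x - q\<close> along the two rays are, up to the positive
  factor \<open>sin \<omega>\<close>, the two cross products. Hence the wedge is an intersection of
  two half-planes.\<close>

lemma mem_wedge_iff:
  assumes "0 < \<omega>" "\<omega> < pi"
  shows "x \<in> wedge \<omega> q (cis \<theta>) \<longleftrightarrow>
    cross (cis \<theta>) (x - q) \<ge> 0 \<and> cross (cis (\<theta> + \<omega>)) (x - q) \<le> 0"
proof -
  have s: "sin \<omega> > 0"
    using assms sin_gt_zero by auto
  have *: "cross (cis \<theta>) (of_real s * cis \<theta> + of_real t * cis (\<theta> + \<omega>)) = t * sin \<omega>"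
    "cross (cis (\<theta> + \<omega>)) (of_real s * cis \<theta> + of_real t * cis (\<theta> + \<omega>)) = - (s * sin \<omega>)" for s t
    using cross_cis[of \<theta> "\<theta> + \<omega>"] by (simp_all add: cross_eq algebra_simps)
  show ?thesis
  proof safe
    assume "x \<in> wedge \<omega> q (cis \<theta>)"
    then obtain s t where st: "s \<ge> 0" "t \<ge> 0" "x = q + of_real s * cis \<theta> + of_real t * (cis \<omega> * cis \<theta>)"
      by (auto simp: wedge_def)
    then have "x - q = of_real s * cis \<theta> + of_real t * cis (\<theta> + \<omega>)"
      by (simp add: cis_mult add.commute)
    then show "cross (cis \<theta>) (x - q) \<ge> 0" "cross (cis (\<theta> + \<omega>)) (x - q) \<le> 0"
      using st(1,2) s by (simp_all only: * ) simp_all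
  next
    assume c: "cross (cis \<theta>) (x - q) \<ge> 0" "cross (cis (\<theta> + \<omega>)) (x - q) \<le> 0"
    define s t where "s = - cross (cis (\<theta> + \<omega>)) (x - q) / sin \<omega>"
      and "t = cross (cis \<theta>) (x - q) / sin \<omega>"
    have "of_real (sin \<omega>) * (x - q) = of_real (sin \<omega> * s) * cis \<theta> + of_real (sin \<omega> * t) * cis (\<theta> + \<omega>)"
    proof -
      have "sin \<omega> * s = cross (x - q) (cis (\<theta> + \<omega>))" "sin \<omega> * t = cross (cis \<theta>) (x - q)"
        using s by (simp_all add: s_def t_def cross_swap[of "x - q"])
      then show ?thesis
        using cross_cramer[of "cis \<theta>" "cis (\<theta> + \<omega>)" "x - q"] by (simp only: cross_cis add_diff_cancel_left')
    qed
    then have "of_real (sin \<omega>) * (x - q) = of_real (sin \<omega>) * (of_real s * cis \<theta> + of_real t * cis (\<theta> + \<omega>))"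
      by (simp add: algebra_simps)
    then have "x - q = of_real s * cis \<theta> + of_real t * cis (\<theta> + \<omega>)"
      using s by simp
    then have "x = q + of_real s * cis \<theta> + of_real t * (cis \<omega> * cis \<theta>)"
      by (simp add: cis_mult add.commute algebra_simps)
    moreover have "s \<ge> 0" "t \<ge> 0"
      using c s by (auto simp: s_def t_def divide_nonneg_pos divide_nonpos_pos)
    ultimately show "x \<in> wedge \<omega> q (cis \<theta>)"
      unfolding wedge_def by blast
  qed
qed

text \<open>On the line carrying one ray, the half-plane belonging to the other ray fixes the sign
  of the parameter.\<close>

lemma mem_first_ray_iff:
  assumes "0 < \<omega>" "\<omega> < pi"
  shows "x \<in> ray q (cis \<theta>) \<longleftrightarrow> x \<in> wedge \<omega> q (cis \<theta>) \<and> cross (cis \<theta>) (x - q) = 0"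
proof -
  have s: "sin \<omega> > 0"
    using assms sin_gt_zero by auto
  have *: "cross (cis (\<theta> + \<omega>)) (of_real t * cis \<theta>) = - (t * sin \<omega>)" for t
    using cross_cis[of \<theta> "\<theta> + \<omega>"] by (simp add: cross_eq algebra_simps)
  show ?thesis
  proof
    assume "x \<in> ray q (cis \<theta>)"
    then obtain t where t: "t \<ge> 0" "x - q = of_real t * cis \<theta>"
      by (auto simp: ray_def)
    then show "x \<in> wedge \<omega> q (cis \<theta>) \<and> cross (cis \<theta>) (x - q) = 0"
      using s by (simp add: mem_wedge_iff[OF assms] * ) (simp add: cross_eq)
  next
    assume r: "x \<in> wedge \<omega> q (cis \<theta>) \<and> cross (cis \<theta>) (x - q) = 0"
    then obtain t where t: "x - q = of_real t * cis \<theta>"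
      using cross_eq_0_imp_scaleR[of "cis \<theta>" "x - q"] by auto
    then have "t \<ge> 0"
      using r s by (simp add: mem_wedge_iff[OF assms] * zero_le_mult_iff)
    then show "x \<in> ray q (cis \<theta>)"
      using t unfolding ray_def by (auto simp: algebra_simps intro!: exI[of _ t])
  qed
qed

lemma mem_second_ray_iff:
  assumes "0 < \<omega>" "\<omega> < pi"
  shows "x \<in> ray q (cis (\<theta> + \<omega>)) \<longleftrightarrow>
    x \<in> wedge \<omega> q (cis \<theta>) \<and> cross (cis (\<theta> + \<omega>)) (x - q) = 0"
proof -
  have s: "sin \<omega> > 0"
    using assms sin_gt_zero by auto
  have *: "cross (cis \<theta>) (of_real t * cis (\<theta> + \<omega>)) = t * sin \<omega>" for t
    using cross_cis[of \<theta> "\<theta> + \<omega>"] by (simp add: cross_eq algebra_simps)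
  show ?thesis
  proof
    assume "x \<in> ray q (cis (\<theta> + \<omega>))"
    then obtain t where t: "t \<ge> 0" "x - q = of_real t * cis (\<theta> + \<omega>)"
      by (auto simp: ray_def)
    then show "x \<in> wedge \<omega> q (cis \<theta>) \<and> cross (cis (\<theta> + \<omega>)) (x - q) = 0"
      using s by (simp add: mem_wedge_iff[OF assms] * ) (simp add: cross_eq)
  next
    assume r: "x \<in> wedge \<omega> q (cis \<theta>) \<and> cross (cis (\<theta> + \<omega>)) (x - q) = 0"
    then obtain t where t: "x - q = of_real t * cis (\<theta> + \<omega>)"
      using cross_eq_0_imp_scaleR[of "cis (\<theta> + \<omega>)" "x - q"] by auto
    then have "t \<ge> 0"
      using r s by (simp add: mem_wedge_iff[OF assms] * zero_le_mult_iff)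
    then show "x \<in> ray q (cis (\<theta> + \<omega>))"
      using t unfolding ray_def by (auto simp: algebra_simps intro!: exI[of _ t])
  qed
qed

lemma convex_wedge: "convex (wedge \<omega> q d)"
  unfolding convex_alt
proof safe
  fix x y u
  assume "x \<in> wedge \<omega> q d" "y \<in> wedge \<omega> q d" and u: "0 \<le> u" "u \<le> (1 :: real)"
  then obtain s t s' t' where st: "s \<ge> 0" "t \<ge> 0" "s' \<ge> 0" "t' \<ge> 0"
    "x = q + of_real s * d + of_real t * (cis \<omega> * d)"
    "y = q + of_real s' * d + of_real t' * (cis \<omega> * d)"
    by (auto simp: wedge_def)
  have "(1 - u) *\<^sub>R x + u *\<^sub>R y = q + of_real ((1 - u) * s + u * s') * d
      + of_real ((1 - u) * t + u * t') * (cis \<omega> * d)"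
    by (simp add: st scaleR_conv_of_real algebra_simps)
  moreover have "(1 - u) * s + u * s' \<ge> 0" "(1 - u) * t + u * t' \<ge> 0"
    using st u by auto
  ultimately show "(1 - u) *\<^sub>R x + u *\<^sub>R y \<in> wedge \<omega> q d"
    unfolding wedge_def by blast
qed

section \<open>Existence of valid probes\<close>

text \<open>The wedge is rotated with both rays kept tangent to the hull: as its direction goes from
  \<open>\<alpha> - \<omega>\<close> to \<open>\<alpha>\<close>, its apex crosses the line through \<open>a\<close> in direction \<open>\<alpha>\<close>.\<close>
lemma valid_probe_exists:
  assumes \<omega>: "0 < \<omega>" "\<omega> < pi" and V: "finite V" and a: "a \<in> convex hull V" and u: "u \<noteq> 0"
  shows "\<exists>q \<theta>. valid_probe \<omega> (convex hull V) (a, u) q \<theta>"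
proof -
  have s: "sin \<omega> > 0"
    using \<omega> sin_gt_zero by auto
  have ne: "V \<noteq> {}"
    using a by auto
  define \<alpha> where "\<alpha> = Arg u"
  have u_eq: "u = of_real (norm u) * cis \<alpha>"
    using u by (simp add: \<alpha>_def Arg_eq cis_conv_exp mult.commute)
  \<comment> \<open>\<open>m\<close> and \<open>M\<close> are the offsets of the supporting lines of
    the hull in the two ray directions; \<open>q\<close> below is the intersection of these lines,
    again by Cramer's rule.\<close>
  define m where "m \<theta> = Min ((\<lambda>v. cross (cis \<theta>) v) ` V)" for \<theta>
  define M where "M \<theta> = Max ((\<lambda>v. cross (cis (\<theta> + \<omega>)) v) ` V)" for \<theta>
  define q where "q \<theta> = (of_real (m \<theta>) * cis (\<theta> + \<omega>) - of_real (M \<theta>) * cis \<theta>) / of_real (sin \<omega>)" for \<theta>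
  have q1: "cross (cis \<theta>) (q \<theta>) = m \<theta>" and q2: "cross (cis (\<theta> + \<omega>)) (q \<theta>) = M \<theta>" for \<theta>
  proof -
    have 1: "cross x (y / of_real r) = cross x y / r" for x y r
      by (simp add: cross_eq diff_divide_distrib)
    have 2: "cross x (of_real r * y - of_real r' * z) = r * cross x y - r' * cross x z" for x y z r r'
      by (simp add: cross_eq algebra_simps)
    show "cross (cis \<theta>) (q \<theta>) = m \<theta>" "cross (cis (\<theta> + \<omega>)) (q \<theta>) = M \<theta>"
      using s by (simp_all add: q_def 1 2 cross_cis)
  qed
  have sub: "convex hull V \<subseteq> wedge \<omega> (q \<theta>) (cis \<theta>)" for \<theta>
  proof (rule hull_minimal)
    show "V \<subseteq> wedge \<omega> (q \<theta>) (cis \<theta>)"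
      using V by (auto simp: mem_wedge_iff[OF \<omega>] cross_diff_right q1 q2 m_def M_def)
  qed (rule convex_wedge)
  have cm: "continuous_on UNIV (\<lambda>\<theta>. Min ((\<lambda>v. g v \<theta>) ` W))"
    and cM: "continuous_on UNIV (\<lambda>\<theta>. Max ((\<lambda>v. g v \<theta>) ` W))"
    if "finite W" "W \<noteq> {}" "\<And>v. continuous_on UNIV (g v)"
    for g :: "complex \<Rightarrow> real \<Rightarrow> real" and W
    using that(1,2)
    by (induction W rule: finite_ne_induct)
      (auto intro!: continuous_intros that(3))
  have cc: "continuous_on UNIV (\<lambda>\<theta>. cross (cis (\<theta> + c)) v)" for c v
    by (simp add: cross_eq) (intro continuous_intros)
  have "continuous_on UNIV m" "continuous_on UNIV M"
    unfolding m_def M_def using cm[OF V ne cc[of 0]] cM[OF V ne cc[of \<omega>]] by simp_all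
  then have cont: "continuous_on UNIV (\<lambda>\<theta>. cross (cis \<alpha>) (q \<theta> - a))"
    unfolding q_def cross_def using s by (intro continuous_intros) auto
  \<comment> \<open>At the two ends of the rotation one ray is parallel to the probing line: the
    second ray at \<open>\<alpha> - \<omega>\<close>, the first at \<open>\<alpha>\<close>. As
    \<open>a\<close> is in the wedge, the apex lies on opposite sides of the line (or on it), and
    the intermediate value theorem applies.\<close>
  have "cross (cis \<alpha>) (q (\<alpha> - \<omega>) - a) \<ge> 0"
    using sub[of "\<alpha> - \<omega>"] a mem_wedge_iff[OF \<omega>, of a "q (\<alpha> - \<omega>)" "\<alpha> - \<omega>"]
    by (auto simp: cross_diff_right)
  moreover have "cross (cis \<alpha>) (q \<alpha> - a) \<le> 0"
    using sub[of \<alpha>] a mem_wedge_iff[OF \<omega>, of a "q \<alpha>" \<alpha>] by (auto simp: cross_diff_right)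
  ultimately obtain \<theta> where \<theta>: "\<alpha> - \<omega> \<le> \<theta>" "\<theta> \<le> \<alpha>" "cross (cis \<alpha>) (q \<theta> - a) = 0"
    using IVT2'[of "\<lambda>\<theta>. cross (cis \<alpha>) (q \<theta> - a)" \<alpha> 0 "\<alpha> - \<omega>"] cont \<omega>
    by (metis continuous_on_subset diff_le_eq le_add_same_cancel1 less_imp_le subset_UNIV)
  obtain t where t: "q \<theta> - a = of_real t * cis \<alpha>"
    using cross_eq_0_imp_scaleR[OF \<theta>(3)] by auto
  then have t': "q \<theta> = a + of_real (t / norm u) * u"
    using u by (subst (2) u_eq) (simp add: algebra_simps)
  \<comment> \<open>The apex cannot lie beyond \<open>a\<close>. Otherwise
    \<open>a - q \<theta>\<close> would point opposite to a direction between the two rays, and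
    membership in the wedge would make both \<open>\<alpha> - \<theta>\<close> and
    \<open>\<theta> + \<omega> - \<alpha>\<close> vanish, although their sum is
    \<open>\<omega>\<close>.\<close>
  have "t \<le> 0"
  proof (rule ccontr)
    assume "\<not> t \<le> 0"
    have "a - q \<theta> = - (of_real t * cis \<alpha>)"
      using t by (simp add: algebra_simps)
    then have "cross (cis \<theta>) (a - q \<theta>) = - (t * sin (\<alpha> - \<theta>))"
      "cross (cis (\<theta> + \<omega>)) (a - q \<theta>) = t * sin (\<theta> + \<omega> - \<alpha>)"
      by (simp_all only: cross_eq) (simp_all add: sin_diff sin_add cos_add algebra_simps)
    moreover have "a \<in> wedge \<omega> (q \<theta>) (cis \<theta>)"
      using sub a by auto
    ultimately have "t * sin (\<alpha> - \<theta>) \<le> 0" "t * sin (\<theta> + \<omega> - \<alpha>) \<le> 0"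
      by (simp_all add: mem_wedge_iff[OF \<omega>])
    then have "sin (\<alpha> - \<theta>) \<le> 0" "sin (\<theta> + \<omega> - \<alpha>) \<le> 0"
      using \<open>\<not> t \<le> 0\<close> by (simp_all add: mult_le_0_iff)
    then have "\<alpha> - \<theta> = 0" "\<theta> + \<omega> - \<alpha> = 0"
      using \<theta> \<omega> sin_gt_zero[of "\<alpha> - \<theta>"] sin_gt_zero[of "\<theta> + \<omega> - \<alpha>"] by linarith+
    then show False
      using \<omega> by simp
  qed
  have "a \<in> ray (q \<theta>) u"
    unfolding ray_def using t' \<open>t \<le> 0\<close>
    by (auto intro!: exI[of _ "- t / norm u"] divide_nonpos_nonneg)
  moreover have "q \<theta> \<in> line_pts a u"
    unfolding line_pts_def using t' by blast
  moreover have "m \<theta> \<in> (\<lambda>v. cross (cis \<theta>) v) ` V" "M \<theta> \<in> (\<lambda>v. cross (cis (\<theta> + \<omega>)) v) ` V"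
    unfolding m_def M_def using V ne by (auto intro!: Min_in Max_in simp del: Min_in Max_in)
  then obtain v w where "v \<in> V" "w \<in> V" "m \<theta> = cross (cis \<theta>) v" "M \<theta> = cross (cis (\<theta> + \<omega>)) w"
    by blast
  then have "v \<in> convex hull V \<inter> ray (q \<theta>) (cis \<theta>)" "w \<in> convex hull V \<inter> ray (q \<theta>) (cis (\<theta> + \<omega>))"
    using sub[of \<theta>] hull_inc[of _ V]
    by (auto simp: mem_first_ray_iff[OF \<omega>, of v] mem_second_ray_iff[OF \<omega>, of w]
        cross_diff_right q1 q2)
  ultimately show ?thesis
    unfolding valid_probe_def using sub[of \<theta>] a by (intro exI[of _ "q \<theta>"] exI[of _ \<theta>]) auto
qed

section \<open>The angle condition keeps the apex outside the polygon\<close>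

text \<open>The claim is that the cosine of the angle is at least \<open>cos \<omega>\<close>. Cross
  and inner product are compared through the wedge coordinates, and the Lagrange identity turns this
  into a bound on the product of the norms. The bound on \<open>\<omega>\<close> enters as
  \<open>cos \<omega> \<ge> 0\<close>.\<close>

lemma vec_angle_le_wedge:
  assumes \<omega>: "0 < \<omega>" "\<omega> \<le> pi / 2"
    and "a \<in> wedge \<omega> q (cis \<theta>)" "b \<in> wedge \<omega> q (cis \<theta>)" "a \<noteq> q" "b \<noteq> q"
  shows "vec_angle (a - q) (b - q) \<le> \<omega>"
proof -
  have c: "cos \<omega> \<ge> 0"
    using \<omega> by (intro cos_ge_zero) auto
  obtain s t where st: "s \<ge> 0" "t \<ge> 0" "a - q = of_real s * cis \<theta> + of_real t * (cis \<omega> * cis \<theta>)"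
    using assms(3) by (auto simp: wedge_def)
  obtain s' t' where st': "s' \<ge> 0" "t' \<ge> 0" "b - q = of_real s' * cis \<theta> + of_real t' * (cis \<omega> * cis \<theta>)"
    using assms(4) by (auto simp: wedge_def)
  \<comment> \<open>Both vectors rotated by \<open>- \<theta>\<close>, so that the first ray becomes
    the positive real axis.\<close>
  define A B where "A = of_real s + of_real t * cis \<omega>" and "B = of_real s' + of_real t' * cis \<omega>"
  have AB: "a - q = A * cis \<theta>" "b - q = B * cis \<theta>"
    unfolding A_def B_def st(3) st'(3) by (simp_all add: algebra_simps)
  have inner_eq: "(a - q) \<bullet> (b - q) = A \<bullet> B"
  proof -
    have "(A * z) \<bullet> (B * z) = (A \<bullet> B) * (norm z)\<^sup>2" for z
      unfolding cmod_power2 inner_complex_def by (simp add: algebra_simps power2_eq_square)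
    then show ?thesis
      by (simp add: AB)
  qed
  have sc: "(sin \<omega>)\<^sup>2 = 1 - (cos \<omega>)\<^sup>2"
    by (simp add: sin_squared_eq)
  have AB_inner: "A \<bullet> B = s * s' + t * t' + cos \<omega> * (s * t' + t * s')"
  proof -
    have "A \<bullet> B = (s + t * cos \<omega>) * (s' + t' * cos \<omega>) + t * t' * (sin \<omega>)\<^sup>2"
      by (simp add: A_def B_def inner_complex_def power2_eq_square)
    then show ?thesis
      unfolding sc by (simp add: algebra_simps power2_eq_square)
  qed
  have AB_cross: "cross A B = sin \<omega> * (s * t' - t * s')"
    by (simp add: A_def B_def cross_eq algebra_simps)
  have "cos \<omega> * \<bar>s * t' - t * s'\<bar> \<le> cos \<omega> * (s * t' + t * s')"
    using c st st' by (intro mult_left_mono) (auto simp: abs_le_iff)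
  also have "\<dots> \<le> A \<bullet> B"
    using st st' by (simp add: AB_inner)
  finally have le: "cos \<omega> * \<bar>s * t' - t * s'\<bar> \<le> A \<bullet> B" .
  then have nonneg: "A \<bullet> B \<ge> 0"
    using c by (meson abs_ge_zero mult_nonneg_nonneg order_trans)
  have "(cos \<omega> * \<bar>s * t' - t * s'\<bar>)\<^sup>2 \<le> (A \<bullet> B)\<^sup>2"
    using le c by (intro power_mono) auto
  then have "(cos \<omega>)\<^sup>2 * (s * t' - t * s')\<^sup>2 \<le> (A \<bullet> B)\<^sup>2"
    by (simp add: power_mult_distrib)
  then have "(sin \<omega>)\<^sup>2 * ((cos \<omega>)\<^sup>2 * (s * t' - t * s')\<^sup>2) \<le> (sin \<omega>)\<^sup>2 * (A \<bullet> B)\<^sup>2"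
    by (intro mult_left_mono) auto
  then have "(cos \<omega>)\<^sup>2 * (cross A B)\<^sup>2 \<le> (1 - (cos \<omega>)\<^sup>2) * (A \<bullet> B)\<^sup>2"
    by (simp add: AB_cross sc power_mult_distrib mult.left_commute)
  moreover have "(norm A)\<^sup>2 * (norm B)\<^sup>2 = (A \<bullet> B)\<^sup>2 + (cross A B)\<^sup>2"
    unfolding cmod_power2 cross_eq inner_complex_def by algebra
  then have "(cos \<omega> * (norm A * norm B))\<^sup>2 = (cos \<omega>)\<^sup>2 * ((A \<bullet> B)\<^sup>2 + (cross A B)\<^sup>2)"
    by (simp add: power_mult_distrib)
  ultimately have "(cos \<omega> * (norm A * norm B))\<^sup>2 \<le> (A \<bullet> B)\<^sup>2"
    by (simp add: algebra_simps)
  then have main: "cos \<omega> * (norm A * norm B) \<le> A \<bullet> B"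
    using nonneg by (rule power2_le_imp_le)
  have "norm (a - q) = norm A" "norm (b - q) = norm B"
    by (simp_all add: AB norm_mult)
  moreover have "norm (a - q) * norm (b - q) > 0"
    using assms by simp
  ultimately have "cos \<omega> \<le> ((a - q) \<bullet> (b - q)) / (norm (a - q) * norm (b - q))"
    using main by (simp add: inner_eq pos_le_divide_eq)
  moreover have "((a - q) \<bullet> (b - q)) / (norm (a - q) * norm (b - q)) \<le> 1"
    using norm_cauchy_schwarz[of "a - q" "b - q"] assms(5,6) by (simp add: divide_le_eq_1)
  ultimately have "vec_angle (a - q) (b - q) \<le> arccos (cos \<omega>)"
    unfolding vec_angle_def by (intro arccos_le_arccos) auto
  then show ?thesis
    using \<omega> by (simp add: arccos_cos)
qed

text \<open>The wedge is pointed, so an apex in the hull is an extreme point and therefore a vertex.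
  Its two edges then run inside the wedge and enclose an angle of at most \<open>\<omega>\<close>,
  against \<open>angles_gt\<close>.\<close>

lemma apex_notin_hull:
  assumes \<omega>: "0 < \<omega>" "\<omega> \<le> pi / 2" and V: "convex_polygon V" "angles_gt \<omega> V"
    and sub: "V \<subseteq> wedge \<omega> q (cis \<theta>)"
  shows "q \<notin> convex hull V"
proof
  assume q: "q \<in> convex hull V"
  have \<omega>': "\<omega> < pi"
    using \<omega> by simp
  have fin: "finite V"
    using V by (simp add: convex_polygon_def)
  have hull: "convex hull V \<subseteq> wedge \<omega> q (cis \<theta>)"
    using sub by (intro hull_minimal convex_wedge)
  have "q extreme_point_of (convex hull V)"
    unfolding extreme_point_of_def
  proof (intro conjI q ballI notI)
    fix y z
    assume yz: "y \<in> convex hull V" "z \<in> convex hull V" "q \<in> open_segment y z"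
    then obtain u where u: "y \<noteq> z" "0 < u" "u < 1" "q = (1 - u) *\<^sub>R y + u *\<^sub>R z"
      by (auto simp: in_segment)
    have lin: "(1 - u) * cross d (y - q) + u * cross d (z - q) = 0" for d
    proof -
      have "(1 - u) * cross d (y - q) + u * cross d (z - q) = cross d ((1 - u) *\<^sub>R y + u *\<^sub>R z - q)"
        by (simp add: cross_eq algebra_simps)
      then show ?thesis
        using u(4) by (simp add: cross_eq)
    qed
    have pos: "cross (cis \<theta>) (x - q) \<ge> 0" "cross (cis (\<theta> + \<omega>)) (x - q) \<le> 0"
      if "x \<in> convex hull V" for x
      using hull that mem_wedge_iff[OF \<omega>(1) \<omega>'] by auto
    \<comment> \<open>Two numbers of the same weak sign with a vanishing positive combination are
      both zero. Applied to the two cross products of \<open>y - q\<close> and \<open>z - q\<close>,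
      it forces \<open>y = q\<close> and \<open>z = q\<close>.\<close>
    have zero: "\<alpha> = 0 \<and> \<beta> = 0" if "(1 - u) * \<alpha> + u * \<beta> = 0" "\<alpha> \<ge> 0 \<and> \<beta> \<ge> 0 \<or> \<alpha> \<le> 0 \<and> \<beta> \<le> 0" for \<alpha> \<beta>
      using that u(2,3) by (smt (verit) mult_nonneg_nonneg mult_nonneg_nonpos mult_pos_pos mult_pos_neg)
    have "x - q = 0" if "cross (cis \<theta>) (x - q) = 0" "cross (cis (\<theta> + \<omega>)) (x - q) = 0" for x
      using that cross_cramer[of "cis \<theta>" "cis (\<theta> + \<omega>)" "x - q"] \<omega>(1) \<omega>' sin_gt_zero[of \<omega>]
      by (simp add: cross_cis cross_swap[of "x - q"])
    moreover have "cross (cis \<theta>) (y - q) = 0 \<and> cross (cis \<theta>) (z - q) = 0"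
      "cross (cis (\<theta> + \<omega>)) (y - q) = 0 \<and> cross (cis (\<theta> + \<omega>)) (z - q) = 0"
      using zero[OF lin] pos yz by auto
    ultimately show False
      using u(1) by (metis eq_iff_diff_eq_0)
  qed
  then have qV: "q \<in> V"
    by (rule extreme_point_of_convex_hull)
  have card: "card (V - {q}) \<ge> 2"
    using V(1) card_Diff_singleton[OF qV] unfolding convex_polygon_def by linarith
  then have "V - {q} \<noteq> {}"
    by (metis card.empty not_numeral_le_zero)
  moreover have "q \<notin> convex hull (V - {q})"
    using V(1) qV by (simp add: convex_polygon_def)
  ultimately obtain a b where ab: "a \<in> V - {q}" "b \<in> V - {q}"
    "\<forall>x\<in>V - {q}. cross (a - q) (x - q) \<ge> 0" "\<forall>x\<in>V - {q}. cross (b - q) (x - q) \<le> 0"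
    using tangent_points[of "V - {q}" q] fin by (metis finite_Diff)
  \<comment> \<open>If both tangents from \<open>q\<close> had the same contact, every vertex would
    lie on one line through \<open>q\<close>.\<close>
  have "a \<noteq> b"
  proof
    assume "a = b"
    obtain x where "x \<in> V - {q}" "x \<noteq> a"
    proof (rule ccontr)
      assume "\<not> thesis"
      then have "V - {q} \<subseteq> {a}"
        using that by blast
      then show False
        using card card_mono[of "{a}" "V - {q}"] by simp
    qed
    then show False
      using ab \<open>a = b\<close> convex_polygon_not_collinear[OF V(1) qV, of a x] by force
  qed
  moreover have "cross (a - q) (q - q) = 0" "cross (b - q) (q - q) = 0"
    by (simp_all add: cross_eq)
  then have "poly_edge V q a" "poly_edge V q b"
    unfolding poly_edge_def using ab qV by (metis DiffD1 DiffD2 DiffI order_refl singletonD singletonI)+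
  ultimately have "vec_angle (a - q) (b - q) > \<omega>"
    using V(2) unfolding angles_gt_def by blast
  moreover have "vec_angle (a - q) (b - q) \<le> \<omega>"
    using ab sub by (intro vec_angle_le_wedge[OF \<omega>, of _ _ \<theta>]) auto
  ultimately show False
    by simp
qed

section \<open>What a single probe reveals\<close>

text \<open>The closest contact point is an extreme point because the ray lies on a supporting line;
  the sign \<open>\<sigma>\<close> tells on which side.\<close>
lemma closest_contact_is_vertex:
  assumes d: "norm d = 1" and "\<sigma> \<noteq> 0"
    and side: "\<And>y. y \<in> convex hull V \<Longrightarrow> \<sigma> * cross d (y - q) \<ge> 0"
    and ray: "\<And>y. y \<in> convex hull V \<Longrightarrow> cross d (y - q) = 0 \<Longrightarrow> y \<in> ray q d"
    and x: "closest_on (convex hull V \<inter> ray q d) q x"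
  shows "x \<in> V"
proof -
  have xV: "x \<in> convex hull V" "x \<in> ray q d"
    and min: "\<And>y. y \<in> convex hull V \<Longrightarrow> y \<in> ray q d \<Longrightarrow> dist q x \<le> dist q y"
    using x by (auto simp: closest_on_def)
  have "x extreme_point_of (convex hull V)"
    unfolding extreme_point_of_def
  proof (intro conjI xV ballI notI)
    fix y z
    assume yz: "y \<in> convex hull V" "z \<in> convex hull V" "x \<in> open_segment y z"
    then obtain u where u: "y \<noteq> z" "0 < u" "u < 1" "x = (1 - u) *\<^sub>R y + u *\<^sub>R z"
      by (auto simp: in_segment)
    have "cross d (x - q) = 0"
      using xV(2) by (auto simp: ray_def cross_eq)
    then have "(1 - u) * (\<sigma> * cross d (y - q)) + u * (\<sigma> * cross d (z - q)) = 0"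
      unfolding u(4) by (simp add: cross_eq) algebra
    then have "\<sigma> * cross d (y - q) = 0" "\<sigma> * cross d (z - q) = 0"
      using side[OF yz(1)] side[OF yz(2)] u(2,3)
      by (smt (verit) mult_nonneg_nonneg mult_pos_pos)+
    then have yr: "y \<in> ray q d" and zr: "z \<in> ray q d"
      using ray yz \<open>\<sigma> \<noteq> 0\<close> by auto
    obtain s t where st: "s \<ge> 0" "y = q + of_real s * d" "t \<ge> 0" "z = q + of_real t * d"
      using yr zr by (auto simp: ray_def)
    \<comment> \<open>On the ray the parameter is the distance from \<open>q\<close>. By minimality
      the average of \<open>s\<close> and \<open>t\<close> with positive weights exceeds neither of
      them, so they agree.\<close>
    have "x = q + of_real ((1 - u) * s + u * t) * d"
      by (simp add: u(4) st scaleR_conv_of_real algebra_simps)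
    moreover have "dist q (q + of_real r * d) = r" if "r \<ge> 0" for r
      using that d by (simp add: dist_norm norm_mult)
    moreover have "(1 - u) * s + u * t \<ge> 0"
      using st u by simp
    ultimately have "(1 - u) * s + u * t \<le> s" "(1 - u) * s + u * t \<le> t"
      using min[OF yz(1) yr] min[OF yz(2) zr] st by metis+
    then have "u * (t - s) \<le> 0" "(1 - u) * (s - t) \<le> 0"
      by (simp_all add: algebra_simps)
    then have "s = t"
      using u by (auto simp: mult_le_0_iff)
    then show False
      using u(1) st by simp
  qed
  then show ?thesis
    by (rule extreme_point_of_convex_hull)
qed

text \<open>The first two alternatives of the conclusion are the flush cases, with the polygon to the left and to
  the right of the probing line, respectively.\<close>
lemma probe_outcome:
  assumes \<omega>: "0 < \<omega>" "\<omega> \<le> pi / 2" and V: "convex_polygon V" "angles_gt \<omega> V"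
    and a: "a \<in> convex hull V" and u: "u \<noteq> 0"
    and adm: "admissible \<omega> (convex hull V) (a, u) r"
  obtains q \<theta> p1 p2 where "r = Some (q, \<theta>, p1, p2)" "V \<subseteq> wedge \<omega> q (cis \<theta>)"
    "p1 \<in> V" "p2 \<in> V" "p1 \<noteq> p2"
    "wedge \<omega> q (cis \<theta>) \<subseteq> left_of a (a + u) \<and> cross u (p2 - a) > 0 \<or>
     wedge \<omega> q (cis \<theta>) \<subseteq> left_of (a + u) a \<and> cross u (p1 - a) < 0 \<or>
     cross u (p1 - a) < 0 \<and> cross u (p2 - a) > 0"
proof -
  have \<omega>': "0 < \<omega>" "\<omega> < pi"
    using \<omega> by auto
  have sin: "sin \<omega> > 0"
    using \<omega>' sin_gt_zero by auto
  have "r \<noteq> None"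
    using valid_probe_exists[OF \<omega>' _ a u] V(1) adm
    by (auto simp: admissible_def convex_polygon_def split: option.splits)
  then obtain q \<theta> p1 p2 where r: "r = Some (q, \<theta>, p1, p2)"
    by (metis option.exhaust prod_cases4)
  then have valid: "valid_probe \<omega> (convex hull V) (a, u) q \<theta>"
    and close: "closest_on (convex hull V \<inter> ray q (cis \<theta>)) q p1"
      "closest_on (convex hull V \<inter> ray q (cis (\<theta> + \<omega>))) q p2"
    using adm by (auto simp: admissible_def)
  have hull: "convex hull V \<subseteq> wedge \<omega> q (cis \<theta>)"
    using valid by (simp add: valid_probe_def)
  then have sub: "V \<subseteq> wedge \<omega> q (cis \<theta>)"
    using hull_subset[of V convex] by blast
  have q: "q \<notin> convex hull V"
    using apex_notin_hull[OF \<omega> V sub] .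
  \<comment> \<open>The polygon lies to the left of the first ray and to the right of the second,
    hence the signs \<open>1\<close> here and \<open>-1\<close> for \<open>p2\<close>.\<close>
  have p1: "p1 \<in> V"
    using hull by (intro closest_contact_is_vertex[OF _ _ _ _ close(1), of 1])
      (auto simp: mem_first_ray_iff[OF \<omega>'] mem_wedge_iff[OF \<omega>'])
  have p2: "p2 \<in> V"
    using hull by (intro closest_contact_is_vertex[OF _ _ _ _ close(2), of "-1"])
      (auto simp: mem_second_ray_iff[OF \<omega>'] mem_wedge_iff[OF \<omega>'])
  have "p1 \<noteq> q" "p2 \<noteq> q"
    using p1 p2 q hull_inc by metis+
  then obtain \<rho>1 \<rho>2 where \<rho>: "\<rho>1 > 0" "p1 = q + of_real \<rho>1 * cis \<theta>" "\<rho>2 > 0" "p2 = q + of_real \<rho>2 * cis (\<theta> + \<omega>)"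
    using close by (force simp: closest_on_def ray_def less_le)
  obtain \<tau> where \<tau>: "q = a + of_real \<tau> * u"
    using valid by (auto simp: valid_probe_def line_pts_def)
  obtain x \<rho> where x: "x \<in> convex hull V" "\<rho> \<ge> 0" "x = q + of_real \<rho> * u"
    using valid by (auto simp: valid_probe_def ray_def)
  have "\<rho> > 0"
    using x q by (cases "\<rho> = 0") auto
  obtain s t where st: "s \<ge> 0" "t \<ge> 0" "x = q + of_real s * cis \<theta> + of_real t * (cis \<omega> * cis \<theta>)"
    using x(1) hull unfolding wedge_def by blast
  then have "of_real \<rho> * u = of_real s * cis \<theta> + of_real t * cis (\<theta> + \<omega>)"
    using x by (simp add: cis_mult add.commute)
  \<comment> \<open>The probing ray meets the hull, which lies in the wedge, so \<open>u\<close> is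
    a nonnegative combination of the ray directions. If \<open>t = 0\<close> the first ray is flush
    with the probing line, if \<open>s = 0\<close> the second; if both are positive the line runs
    strictly between the rays and separates the contacts.\<close>
  then have u_eq: "u = of_real (s / \<rho>) * cis \<theta> + of_real (t / \<rho>) * cis (\<theta> + \<omega>)"
    using \<open>\<rho> > 0\<close> by (simp add: field_simps)
  have nz: "s > 0 \<or> t > 0"
    using u st(1,2) unfolding u_eq by (cases "s = 0"; cases "t = 0") auto
  have cross_u: "cross u (y - a) = s / \<rho> * cross (cis \<theta>) (y - q) + t / \<rho> * cross (cis (\<theta> + \<omega>)) (y - q)" for y
  proof -
    have "cross u (y - a) = cross u (y - q)"
      unfolding \<tau> by (simp add: cross_eq algebra_simps)
    also have "\<dots> = s / \<rho> * cross (cis \<theta>) (y - q) + t / \<rho> * cross (cis (\<theta> + \<omega>)) (y - q)"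
      unfolding u_eq by (rule cross_combination)
    finally show ?thesis .
  qed
  have 0: "cross z (of_real k * w) = k * cross z w" for z w k
    by (simp add: cross_eq algebra_simps)
  have crp1: "cross u (p1 - a) = - (t / \<rho> * (\<rho>1 * sin \<omega>))"
    unfolding cross_u \<rho>(2) by (simp add: 0 cross_cis)
  have crp2: "cross u (p2 - a) = s / \<rho> * (\<rho>2 * sin \<omega>)"
    unfolding cross_u \<rho>(4) by (simp add: 0 cross_cis)
  have "p1 \<noteq> p2"
  proof
    assume "p1 = p2"
    then have "s / \<rho> * (\<rho>2 * sin \<omega>) + t / \<rho> * (\<rho>1 * sin \<omega>) = 0"
      using crp1 crp2 by simp
    moreover have "s / \<rho> * (\<rho>2 * sin \<omega>) \<ge> 0" "t / \<rho> * (\<rho>1 * sin \<omega>) \<ge> 0"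
      using st \<rho> \<open>\<rho> > 0\<close> sin by simp_all
    ultimately have "s / \<rho> * (\<rho>2 * sin \<omega>) = 0" "t / \<rho> * (\<rho>1 * sin \<omega>) = 0"
      by linarith+
    then show False
      using nz \<rho> \<open>\<rho> > 0\<close> sin by auto
  qed
  have s_pos: "cross u (p2 - a) > 0" if "s > 0"
    unfolding crp2 using that \<rho>(3) \<open>\<rho> > 0\<close> sin by simp
  have t_pos: "cross u (p1 - a) < 0" if "t > 0"
    unfolding crp1 using that \<rho>(1) \<open>\<rho> > 0\<close> sin by simp
  have t_0: "wedge \<omega> q (cis \<theta>) \<subseteq> left_of a (a + u)" if "t = 0"
    using that st(1) \<open>\<rho> > 0\<close> by (auto simp: left_of_def cross_u mem_wedge_iff[OF \<omega>'])
  have s_0: "wedge \<omega> q (cis \<theta>) \<subseteq> left_of (a + u) a" if "s = 0"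
  proof
    fix y
    assume "y \<in> wedge \<omega> q (cis \<theta>)"
    then have "t / \<rho> * cross (cis (\<theta> + \<omega>)) (y - q) \<le> 0"
      using st(2) \<open>\<rho> > 0\<close> by (intro mult_nonneg_nonpos) (auto simp: mem_wedge_iff[OF \<omega>'])
    then have "cross u (y - a) \<le> 0"
      using that by (simp add: cross_u)
    then show "y \<in> left_of (a + u) a"
      by (simp add: left_of_def cross_eq algebra_simps)
  qed
  show ?thesis
    using that[OF r sub p1 p2 \<open>p1 \<noteq> p2\<close>] nz s_pos t_pos s_0 t_0 st(1,2) by fastforce
qed

section \<open>The strategy, its progress measure and the count of probes\<close>

definition contacts :: "response list \<Rightarrow> complex set" where
  "contacts h = {x. \<exists>q \<theta> p1 p2. Some (q, \<theta>, p1, p2) \<in> set h \<and> x \<in> {p1, p2}}"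

text \<open>The test refers to a wedge, which the prober has seen, and not to the unknown polygon;
  thus the set is computed from the history alone.\<close>

definition confirmed :: "real \<Rightarrow> response list \<Rightarrow> (complex \<times> complex) set" where
  "confirmed \<omega> h = {(a, b). a \<in> contacts h \<and> b \<in> contacts h \<and> a \<noteq> b \<and>
     (\<exists>q \<theta> p1 p2. Some (q, \<theta>, p1, p2) \<in> set h \<and> wedge \<omega> q (cis \<theta>) \<subseteq> left_of a b)}"

text \<open>The potential of the counting argument: for a consistent history it is at most
  \<open>2 * card V\<close>, by \<open>confirmed_subset\<close> and
  \<open>card_hull_edges_le\<close>.\<close>

definition progress :: "real \<Rightarrow> response list \<Rightarrow> nat" where
  "progress \<omega> h = card (contacts h) + card (confirmed \<omega> h)"

text \<open>Invariant of the histories that arise. No answer is a miss, because every probing line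
  passes through a point of the polygon.\<close>

definition consistent :: "real \<Rightarrow> complex set \<Rightarrow> response list \<Rightarrow> bool" where
  "consistent \<omega> V h \<longleftrightarrow> (\<forall>r\<in>set h. \<exists>q \<theta> p1 p2. r = Some (q, \<theta>, p1, p2) \<and>
     V \<subseteq> wedge \<omega> q (cis \<theta>) \<and> p1 \<in> V \<and> p2 \<in> V \<and> p1 \<noteq> p2)"

text \<open>The empty history is a case of its own, since without contacts the stopping test would
  hold vacuously. The direction \<open>1\<close> of the first probe and the choice of the
  unconfirmed edge are arbitrary.\<close>

definition edge_strategy :: "real \<Rightarrow> strategy" where
  "edge_strategy \<omega> i h =
     (if h = [] then Probe (fst i, 1)
      else if hull_edges (contacts h) \<subseteq> confirmed \<omega> h then Answer (contacts h)
      else let (a, b) = SOME e. e \<in> hull_edges (contacts h) - confirmed \<omega> h in Probe (a, b - a))"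

lemma contacts_snoc: "contacts (h @ [Some (q, \<theta>, p1, p2)]) = insert p1 (insert p2 (contacts h))"
  by (auto simp: contacts_def)

lemma confirmed_mono: "confirmed \<omega> h \<subseteq> confirmed \<omega> (h @ h')"
  by (fastforce simp: confirmed_def contacts_def)

lemma contacts_subset: "consistent \<omega> V h \<Longrightarrow> contacts h \<subseteq> V"
  by (fastforce simp: consistent_def contacts_def)

lemma confirmed_subset:
  assumes "consistent \<omega> V h"
  shows "confirmed \<omega> h \<subseteq> hull_edges V"
proof clarify
  fix a b
  assume ab: "(a, b) \<in> confirmed \<omega> h"
  then obtain q \<theta> p1 p2 where "Some (q, \<theta>, p1, p2) \<in> set h" "wedge \<omega> q (cis \<theta>) \<subseteq> left_of a b"
    by (auto simp: confirmed_def)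
  then have "V \<subseteq> left_of a b"
    using assms by (fastforce simp: consistent_def)
  then show "(a, b) \<in> hull_edges V"
    using ab contacts_subset[OF assms] by (auto simp: confirmed_def hull_edges_def)
qed

lemma card_contacts_ge_2:
  assumes "consistent \<omega> V h" "finite V" "h \<noteq> []"
  shows "card (contacts h) \<ge> 2"
proof -
  have "hd h \<in> set h"
    using assms(3) by simp
  then obtain q \<theta> p1 p2 where "Some (q, \<theta>, p1, p2) \<in> set h" "p1 \<noteq> p2"
    using assms(1) by (metis consistent_def)
  then have "{p1, p2} \<subseteq> contacts h" "card {p1, p2} = 2"
    by (auto simp: contacts_def)
  then show ?thesis
    using card_mono[of "contacts h" "{p1, p2}"] finite_subset[OF contacts_subset[OF assms(1)] assms(2)]
    by simp
qed

text \<open>Correctness of every answer: once all hull edges of the contacts are confirmed, they are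
  edges of \<open>V\<close>, and \<open>hull_edges_subset_imp_eq\<close> applies.\<close>

lemma edge_strategy_cases:
  assumes "consistent \<omega> V h" "convex_polygon V" "h \<noteq> []"
  obtains "edge_strategy \<omega> i h = Answer V"
  | a b where "edge_strategy \<omega> i h = Probe (a, b - a)" "(a, b) \<in> hull_edges (contacts h) - confirmed \<omega> h"
proof (cases "hull_edges (contacts h) \<subseteq> confirmed \<omega> h")
  case True
  then have "contacts h = V"
    using hull_edges_subset_imp_eq[OF assms(2) contacts_subset[OF assms(1)]] confirmed_subset[OF assms(1)]
      card_contacts_ge_2[OF assms(1) _ assms(3)] assms(2)
    by (auto simp: convex_polygon_def)
  then show ?thesis
    using that(1) True assms(3) by (simp add: edge_strategy_def)
next
  case False
  obtain a b where ab: "(SOME e. e \<in> hull_edges (contacts h) - confirmed \<omega> h) = (a, b)"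
    by fastforce
  moreover have "(SOME e. e \<in> hull_edges (contacts h) - confirmed \<omega> h) \<in> hull_edges (contacts h) - confirmed \<omega> h"
    by (rule someI_ex) (use False in blast)
  ultimately show ?thesis
    using that(2)[of a b] False assms(3) by (simp add: edge_strategy_def)
qed

text \<open>The absolute bound \<open>4\<close> serves the second probe, the strict increase all
  later ones. The four items are \<open>a\<close>, \<open>b\<close>, and either two further contacts
  or one further contact with a confirmed edge.\<close>

lemma edge_probe_progress:
  assumes \<omega>: "0 < \<omega>" "\<omega> \<le> pi / 2" and V: "convex_polygon V" "angles_gt \<omega> V"
    and h: "consistent \<omega> V h" and ab: "(a, b) \<in> hull_edges (contacts h) - confirmed \<omega> h"
    and adm: "admissible \<omega> (convex hull V) (a, b - a) r"
  shows "consistent \<omega> V (h @ [r])" "progress \<omega> (h @ [r]) \<ge> 4"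
    "progress \<omega> (h @ [r]) > progress \<omega> h"
proof -
  have abK: "a \<in> contacts h" "b \<in> contacts h" "a \<noteq> b"
    and left: "\<And>x. x \<in> contacts h \<Longrightarrow> cross (b - a) (x - a) \<ge> 0"
    using ab by (auto simp: hull_edges_def left_of_def)
  have aV: "a \<in> convex hull V"
    using hull_inc[OF subsetD[OF contacts_subset[OF h] abK(1)]] .
  have "b - a \<noteq> 0"
    using abK(3) by simp
  then obtain q \<theta> p1 p2 where r: "r = Some (q, \<theta>, p1, p2)" and sub: "V \<subseteq> wedge \<omega> q (cis \<theta>)"
    and p: "p1 \<in> V" "p2 \<in> V" "p1 \<noteq> p2"
    and gain: "wedge \<omega> q (cis \<theta>) \<subseteq> left_of a b \<and> cross (b - a) (p2 - a) > 0 \<or>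
     wedge \<omega> q (cis \<theta>) \<subseteq> left_of b a \<and> cross (b - a) (p1 - a) < 0 \<or>
     cross (b - a) (p1 - a) < 0 \<and> cross (b - a) (p2 - a) > 0"
    using probe_outcome[OF \<omega> V aV _ adm, unfolded add_diff_eq add_diff_cancel_left'] by blast
  let ?h = "h @ [r]"
  show cons: "consistent \<omega> V ?h"
    using h r sub p by (auto simp: consistent_def)
  have fin: "finite (contacts ?h)" "finite (confirmed \<omega> ?h)"
    using contacts_subset[OF cons] confirmed_subset[OF cons] V(1) finite_hull_edges[of V] finite_subset
    by (auto simp: convex_polygon_def)
  have K: "contacts ?h = insert p1 (insert p2 (contacts h))"
    by (simp add: r contacts_snoc)
  have conf: "(a, b) \<in> confirmed \<omega> ?h" if "wedge \<omega> q (cis \<theta>) \<subseteq> left_of a b"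
    using that abK unfolding confirmed_def K by (auto simp: r)
  have conf': "(b, a) \<in> confirmed \<omega> ?h" if "wedge \<omega> q (cis \<theta>) \<subseteq> left_of b a"
    using that abK unfolding confirmed_def K by (auto simp: r)
  have off: "x \<noteq> a" "x \<noteq> b" if "cross (b - a) (x - a) \<noteq> 0" for x
    using that by (auto simp: cross_eq)
  have three: "card (contacts ?h) \<ge> 3" if "x \<in> contacts ?h" "cross (b - a) (x - a) \<noteq> 0" for x
  proof -
    have "card {a, b, x} = 3"
      using off[OF that(2)] abK(3) by simp
    then show ?thesis
      using card_mono[OF fin(1), of "{a, b, x}"] that(1) abK K by auto
  qed
  have one: "card (confirmed \<omega> ?h) \<ge> 1" if "e \<in> confirmed \<omega> ?h" for e
    using that fin(2) by (metis One_nat_def Suc_leI card_gt_0_iff empty_iff)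
  from gain show "progress \<omega> ?h \<ge> 4"
  proof (elim disjE conjE)
    assume "wedge \<omega> q (cis \<theta>) \<subseteq> left_of a b" "cross (b - a) (p2 - a) > 0"
    then show ?thesis
      using three[of p2] one[OF conf] by (simp add: K progress_def)
  next
    assume "wedge \<omega> q (cis \<theta>) \<subseteq> left_of b a" "cross (b - a) (p1 - a) < 0"
    then show ?thesis
      using three[of p1] one[OF conf'] by (simp add: K progress_def)
  next
    assume "cross (b - a) (p1 - a) < 0" "cross (b - a) (p2 - a) > 0"
    then have "card {a, b, p1, p2} = 4"
      using off[of p1] off[of p2] abK(3) p(3) by simp
    then show ?thesis
      using card_mono[OF fin(1), of "{a, b, p1, p2}"] abK K by (auto simp: progress_def)
  qed
  have "contacts h \<subseteq> contacts ?h" "confirmed \<omega> h \<subseteq> confirmed \<omega> ?h"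
    using K confirmed_mono by auto
  \<comment> \<open>Either \<open>(a, b)\<close> becomes confirmed, or \<open>p1\<close> lies
    strictly to the right of it, where no known vertex is.\<close>
  moreover have "contacts h \<noteq> contacts ?h \<or> confirmed \<omega> h \<noteq> confirmed \<omega> ?h"
  proof (cases "wedge \<omega> q (cis \<theta>) \<subseteq> left_of a b")
    case True
    then show ?thesis
      using conf ab by blast
  next
    case False
    then have "p1 \<notin> contacts h"
      using gain left[of p1] by linarith
    then show ?thesis
      using K by blast
  qed
  ultimately show "progress \<omega> ?h > progress \<omega> h"
    unfolding progress_def using fin
    by (meson add_le_less_mono add_less_le_mono card_mono psubset_card_mono psubsetI)
qed

text \<open>Induction on the number \<open>k\<close> of probes left, which covers the items still to
  be gained. An earlier answer is accepted by \<open>determines\<close> as well.\<close>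

lemma edge_strategy_determines:
  assumes \<omega>: "0 < \<omega>" "\<omega> \<le> pi / 2" and V: "convex_polygon V" "angles_gt \<omega> V"
    and "consistent \<omega> V h" "h \<noteq> []" "2 * card V \<le> progress \<omega> h + k"
  shows "determines \<omega> (edge_strategy \<omega>) i V k h"
  using assms(5-)
proof (induction k arbitrary: h)
  case 0
  have finV: "finite V"
    using V(1) by (simp add: convex_polygon_def)
  have sub: "contacts h \<subseteq> V" "confirmed \<omega> h \<subseteq> hull_edges V"
    using contacts_subset confirmed_subset "0.prems" by auto
  \<comment> \<open>With no probe left the progress reaches its upper bound, so both sets are
    complete and the stopping test succeeds.\<close>
  then have "card (contacts h) \<le> card V" "card (confirmed \<omega> h) \<le> card (hull_edges V)"
    using finV finite_hull_edges by (auto intro: card_mono)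
  then have "card (contacts h) = card V" "card (confirmed \<omega> h) = card (hull_edges V)"
    using card_hull_edges_le[OF V(1)] "0.prems"(3) by (auto simp: progress_def)
  then have "contacts h = V" "confirmed \<omega> h = hull_edges V"
    using sub finV finite_hull_edges card_subset_eq by metis+
  then show ?case
    using "0.prems"(2) by (simp add: edge_strategy_def)
next
  case (Suc k)
  show ?case
  proof (rule edge_strategy_cases[OF Suc.prems(1) V(1) Suc.prems(2), of i])
    fix a b
    assume S: "edge_strategy \<omega> i h = Probe (a, b - a)"
      and ab: "(a, b) \<in> hull_edges (contacts h) - confirmed \<omega> h"
    have "determines \<omega> (edge_strategy \<omega>) i V k (h @ [r])"
      if "admissible \<omega> (convex hull V) (a, b - a) r" for r
      using edge_probe_progress[OF \<omega> V Suc.prems(1) ab that] Suc.prems(3)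
      by (intro Suc.IH) auto
    then show ?thesis
      using S ab by (auto simp: hull_edges_def)
  qed simp
qed

theorem theorem4p1:
  fixes \<omega> :: real
  assumes "0 < \<omega>" and "\<omega> \<le> pi / 2"
  shows "\<exists>S :: strategy. \<forall>V p c R.
           convex_polygon V \<and> angles_gt \<omega> V \<and>
           p \<in> convex hull V \<and> convex hull V \<subseteq> cball c R \<longrightarrow>
           determines \<omega> S (p, c, R) V (2 * card V - 2) []"
proof (intro exI allI impI)
  fix V p c R
  assume "convex_polygon V \<and> angles_gt \<omega> V \<and> p \<in> convex hull V \<and> convex hull V \<subseteq> cball c R"
  then have V: "convex_polygon V" "angles_gt \<omega> V" and p: "p \<in> convex hull V"
    by auto
  define i where "i = (p, c, R)"
  let ?S = "edge_strategy \<omega>"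
  have "card V \<ge> 3"
    using V(1) by (simp add: convex_polygon_def)
  \<comment> \<open>Two probes bring the progress to at least \<open>4\<close>; each further one
    adds at least one of the remaining \<open>2 * card V - 4\<close> items.\<close>
  define k where "k = 2 * card V - 4"
  with \<open>card V \<ge> 3\<close> have k: "2 * card V = k + 4" "2 * card V - 2 = Suc (Suc k)"
    by simp_all
  have "determines \<omega> ?S i V (Suc k) [r]" if r: "admissible \<omega> (convex hull V) (p, 1) r" for r
  proof -
    have h: "consistent \<omega> V [r]"
      using probe_outcome[OF assms V p _ r] by (fastforce simp: consistent_def)
    show ?thesis
    proof (rule edge_strategy_cases[OF h V(1), of i])
      fix a b
      assume S: "?S i [r] = Probe (a, b - a)"
        and ab: "(a, b) \<in> hull_edges (contacts [r]) - confirmed \<omega> [r]"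
      have "determines \<omega> ?S i V k ([r] @ [r'])"
        if "admissible \<omega> (convex hull V) (a, b - a) r'" for r'
        using edge_probe_progress[OF assms V h ab that] k(1)
        by (intro edge_strategy_determines[OF assms V]) auto
      then show ?thesis
        using S ab by (auto simp: hull_edges_def)
    qed simp_all
  qed
  then show "determines \<omega> ?S (p, c, R) V (2 * card V - 2) []"
    unfolding k(2) i_def[symmetric] by (simp add: edge_strategy_def i_def)
qed

end
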